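(* Let $\boldsymbol D_{(1)}$ and $\boldsymbol D_{(2)}$ be independent splits of the data, let $\boldsymbol\Psi\mid\boldsymbol D_{(1)}$ be the posterior distribution of the parameter $\boldsymbol\Psi$ computed from $\boldsymbol D_{(1)}$, and suppose that $\Delta(\boldsymbol\Psi,\boldsymbol D_{(2)})=\boldsymbol g^T(\boldsymbol D_{(2)})\,\boldsymbol f(\boldsymbol\Psi)$ for some vector-valued functions $\boldsymbol f$ and $\boldsymbol g$, where all expectations and variances below exist and are finite. Then $$E_{\boldsymbol D_{(2)}}\Big[\mathrm{Var}_{\boldsymbol D_{(1)}}\big\{E_{\boldsymbol\Psi\mid\boldsymbol D_{(1)}}[\Delta(\boldsymbol\Psi,\boldsymbol D_{(2)})]\big\}\Big]\;\ge\;\mathrm{Var}_{\boldsymbol D_{(1)}}\Big[E_{\boldsymbol D_{(2)}}\big\{E_{\boldsymbol\Psi\mid\boldsymbol D_{(1)}}[\Delta(\boldsymbol\Psi,\boldsymbol D_{(2)})]\big\}\Big].$$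
   Context: $E_{\boldsymbol D_{(j)}}$ and $\mathrm{Var}_{\boldsymbol D_{(j)}}$ denote expectation and variance with respect to the sampling distribution of the split $\boldsymbol D_{(j)}$ ($j=1,2$), the other split being held fixed where it appears. $E_{\boldsymbol\Psi\mid\boldsymbol D_{(1)}}[\cdot]$ denotes expectation over $\boldsymbol\Psi$ drawn from its posterior distribution given $\boldsymbol D_{(1)}$, with $\boldsymbol D_{(2)}$ held fixed. $\Delta(\boldsymbol\Psi,\boldsymbol D_{(2)})$ is a real-valued function of the parameter and of the second split; $\boldsymbol f$ and $\boldsymbol g$ take values in the same finite-dimensional Euclidean space. *)

theory Defs
  imports "HOL-Probability.Probability"
begin

text \<open>
  The prior may be improper (any measure on the parameter space), provided that the prior
  predictive measure \<open>prior \<bind> lik\<close> is sigma-finite; the posterior is then determined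
  up to a null set of that measure.  No dominating measure is needed: \<open>post\<close> is a posterior if
  disintegrating the joint measure of parameter and data along the data gives \<open>post\<close>.
  The distribution that actually generates the data plays no role here.
\<close>

definition is_posterior ::
  "'d measure \<Rightarrow> 'p measure \<Rightarrow> ('p \<Rightarrow> 'd measure) \<Rightarrow> ('d \<Rightarrow> 'p measure) \<Rightarrow> bool" where
  "is_posterior N prior lik post \<longleftrightarrow>
     lik \<in> prior \<rightarrow>\<^sub>M prob_algebra N \<and>
     post \<in> N \<rightarrow>\<^sub>M prob_algebra prior \<and>
     sigma_finite_measure (prior \<bind> lik) \<and>
     (\<forall>A\<in>sets prior. \<forall>B\<in>sets N.
        (\<integral>\<^sup>+\<psi>\<in>A. emeasure (lik \<psi>) B \<partial>prior) =
        (\<integral>\<^sup>+d\<in>B. emeasure (post d) A \<partial>(prior \<bind> lik)))"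

text \<open>
  The library's \<open>indep_var\<close> forces both random elements to have values in the same type; this
  is its characterisation \<open>indep_var_eq\<close> for two value types.
\<close>

definition indep_rvs ::
  "'w measure \<Rightarrow> 'a measure \<Rightarrow> ('w \<Rightarrow> 'a) \<Rightarrow> 'b measure \<Rightarrow> ('w \<Rightarrow> 'b) \<Rightarrow> bool" where
  "indep_rvs M N1 X1 N2 X2 \<longleftrightarrow>
     X1 \<in> M \<rightarrow>\<^sub>M N1 \<and> X2 \<in> M \<rightarrow>\<^sub>M N2 \<and>
     prob_space.indep_set M
       (sets (vimage_algebra (space M) X1 N1)) (sets (vimage_algebra (space M) X2 N2))"

lemma (in prob_space) indep_rvs_iff_indep_var:
  "indep_rvs M N1 X1 N2 X2 \<longleftrightarrow> indep_var N1 X1 N2 X2"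
  by (auto simp: indep_rvs_def indep_var_eq sets_vimage_algebra)

definition posterior_mean ::
  "('d1 \<Rightarrow> 'p measure) \<Rightarrow> ('p \<Rightarrow> 'd2 \<Rightarrow> real) \<Rightarrow> 'd1 \<Rightarrow> 'd2 \<Rightarrow> real" where
  "posterior_mean post \<Delta> d1 d2 = (\<integral>\<psi>. \<Delta> \<psi> d2 \<partial>(post d1))"

definition finite_variance :: "'a measure \<Rightarrow> ('a \<Rightarrow> real) \<Rightarrow> bool" where
  "finite_variance P X \<longleftrightarrow> integrable P X \<and> integrable P (\<lambda>x. (X x)\<^sup>2)"

end

theory Submission
  imports Defs
begin

text \<open>
  With \<open>h(d\<^sub>1, d\<^sub>2)\<close> the posterior mean, centre at \<open>m(d\<^sub>2) = E\<^bsub>D1\<^esub> h(D\<^sub>1, d\<^sub>2)\<close>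
  and put \<open>k = h - m\<close>. Finiteness of the left-hand side puts \<open>k\<close> in \<open>L\<^sup>2\<close> of the product, so
  Fubini applies to \<open>k\<close> and \<open>k\<^sup>2\<close> (though perhaps not to \<open>h\<^sup>2\<close>). The right-hand side is
  \<open>E\<^bsub>D1\<^esub> (E\<^bsub>D2\<^esub> k)\<^sup>2 \<le> E\<^bsub>D1\<^esub> E\<^bsub>D2\<^esub> k\<^sup>2\<close>. The bilinear form of \<open>\<Delta>\<close> is
  needed only to make \<open>h\<close> jointly measurable.
\<close>

text \<open>Nonnegativity of the variance; it is applied below to the slices \<open>k x\<close> with
  \<open>x\<close> fixed.\<close>

lemma (in prob_space) expectation_square_le:
  fixes X :: "'a \<Rightarrow> real"
  assumes "integrable M X" "integrable M (\<lambda>x. (X x)\<^sup>2)"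
  shows "(expectation X)\<^sup>2 \<le> expectation (\<lambda>x. (X x)\<^sup>2)"
  using variance_eq[OF assms] variance_positive[of X] by simp

text \<open>The hypotheses do not make \<open>h\<close> square-integrable on the product:
  \<open>h x y = u y\<close> with \<open>u\<close> integrable but not square-integrable satisfies
  them. Hence the centring in \<open>x\<close>, which removes such a part from both sides.\<close>

lemma (in pair_prob_space) variance_expectation_le_expectation_variance:
  fixes h :: "'a \<Rightarrow> 'b \<Rightarrow> real"
  assumes meas[measurable]: "(\<lambda>(x, y). h x y) \<in> borel_measurable (M1 \<Otimes>\<^sub>M M2)"
    and var: "AE y in M2. finite_variance M1 (\<lambda>x. h x y)"
    and int_var: "integrable M2 (\<lambda>y. M1.variance (\<lambda>x. h x y))"
    and int_snd: "AE x in M1. integrable M2 (\<lambda>y. h x y)"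
  shows "M1.variance (\<lambda>x. M2.expectation (\<lambda>y. h x y))
    \<le> M2.expectation (\<lambda>y. M1.variance (\<lambda>x. h x y))"
proof -
  define m where "m y = M1.expectation (\<lambda>x. h x y)" for y
  define k where "k x y = h x y - m y" for x y
  have m_meas[measurable]: "m \<in> borel_measurable M2"
    unfolding m_def by (rule M1.borel_measurable_lebesgue_integral) simp
  have k_meas[measurable]: "(\<lambda>(x, y). k x y) \<in> borel_measurable (M1 \<Otimes>\<^sub>M M2)"
    unfolding k_def by measurable
  have centred: "AE y in M2. M1.expectation (\<lambda>x. k x y) = 0"
    using var by eventually_elim
      (simp add: k_def m_def finite_variance_def M1.prob_space)
  have int_sq_fst: "AE y in M2. integrable M1 (\<lambda>x. (k x y)\<^sup>2)"
    using var by eventually_elim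
      (simp add: k_def finite_variance_def power2_diff)
  have int_var': "integrable M2 (\<lambda>y. M1.expectation (\<lambda>x. (k x y)\<^sup>2))"
    using int_var by (simp add: k_def m_def)
  have int_sq: "integrable (M1 \<Otimes>\<^sub>M M2) (\<lambda>(x, y). (k x y)\<^sup>2)"
  proof -
    \<comment> \<open>The variance integrates over \<open>M1\<close> first, so the Fubini criterion
      is applied to the swapped product and the result is swapped back.\<close>
    interpret Q: pair_sigma_finite M2 M1 ..
    have "integrable (M2 \<Otimes>\<^sub>M M1) (\<lambda>(y, x). (k x y)\<^sup>2)"
      using int_var' int_sq_fst by (intro Q.Fubini_integrable) auto
    then show ?thesis
      by (subst (asm) Q.integrable_product_swap_iff[symmetric]) (simp add: case_prod_beta')
  qed
  have int: "integrable (M1 \<Otimes>\<^sub>M M2) (\<lambda>(x, y). k x y)"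
    using P.square_integrable_imp_integrable[OF k_meas] int_sq
    by (simp add: case_prod_beta')
  have int_snd_k: "AE x in M1. integrable M2 (k x)"
    using AE_integrable_fst'[OF int] by simp
  have int_snd_sq: "AE x in M1. integrable M2 (\<lambda>y. (k x y)\<^sup>2)"
    using AE_integrable_fst'[OF int_sq] by simp
  \<comment> \<open>For almost every \<open>x\<close>, \<open>m\<close> is the difference of the
    integrable slices of \<open>h\<close> and \<open>k\<close>. The claim does not mention
    \<open>x\<close>, and a probability measure is nonzero, so one good \<open>x\<close> is
    enough.\<close>
  have int_m: "integrable M2 m"
  proof -
    have "AE x in M1. integrable M2 m"
      using int_snd int_snd_k
    proof eventually_elim
      case (elim x)
      then have "integrable M2 (\<lambda>y. h x y - k x y)" by (rule Bochner_Integration.integrable_diff)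
      then show ?case by (simp add: k_def)
    qed
    then show ?thesis by simp
  qed
  have split: "AE x in M1. M2.expectation (h x) = M2.expectation (k x) + M2.expectation m"
    using int_snd by eventually_elim (simp add: k_def[abs_def] int_m)
  have zero: "M1.expectation (\<lambda>x. M2.expectation (k x)) = 0"
  proof -
    have "M1.expectation (\<lambda>x. M2.expectation (k x)) = M2.expectation (\<lambda>y. M1.expectation (\<lambda>x. k x y))"
      using Fubini_integral[OF int] by simp
    also have "\<dots> = M2.expectation (\<lambda>y. 0)"
      using centred by (intro integral_cong_AE) auto
    finally show ?thesis by simp
  qed
  have int_Ek: "integrable M1 (\<lambda>x. M2.expectation (k x))"
    using integrable_fst'[OF int] by simp
  have int_Eksq: "integrable M1 (\<lambda>x. M2.expectation (\<lambda>y. (k x y)\<^sup>2))"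
    using integrable_fst'[OF int_sq] by simp
  have mean: "M1.expectation (\<lambda>x. M2.expectation (h x)) = M2.expectation m"
  proof -
    have "M1.expectation (\<lambda>x. M2.expectation (h x))
        = M1.expectation (\<lambda>x. M2.expectation (k x) + M2.expectation m)"
      using split by (intro integral_cong_AE) auto
    then show ?thesis
      using zero int_Ek by (simp add: M1.prob_space)
  qed
  \<comment> \<open>By \<open>split\<close>, the constant \<open>M2.expectation m\<close> cancels in
    the deviation from the mean.\<close>
  have "M1.variance (\<lambda>x. M2.expectation (h x)) = M1.expectation (\<lambda>x. (M2.expectation (k x))\<^sup>2)"
    unfolding mean using split by (intro integral_cong_AE) auto
  also have "\<dots> \<le> M1.expectation (\<lambda>x. M2.expectation (\<lambda>y. (k x y)\<^sup>2))"
  \<comment> \<open>This form of monotonicity asks for integrability of the larger, nonnegative side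
    only.\<close>
  proof (rule integral_mono_AE')
    show "AE x in M1. (M2.expectation (k x))\<^sup>2 \<le> M2.expectation (\<lambda>y. (k x y)\<^sup>2)"
      using int_snd_k int_snd_sq by eventually_elim (rule M2.expectation_square_le)
  qed (use int_Eksq in auto)
  also have "\<dots> = M2.expectation (\<lambda>y. M1.expectation (\<lambda>x. (k x y)\<^sup>2))"
    using Fubini_integral[OF int_sq] by simp
  finally show ?thesis
    by (simp add: k_def m_def)
qed

text \<open>Both the integrand and the measure vary with \<open>x\<close>. Pushing
  \<open>L x\<close> forward along \<open>f x\<close> moves all dependence into the measure: the
  integral is the mean of a law on the target space, and that law depends measurably on
  \<open>x\<close>.\<close>

lemma measurable_integral_kernel:
  fixes f :: "'a \<Rightarrow> 'b \<Rightarrow> 'c::{banach, second_countable_topology}"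
  assumes f: "(\<lambda>(x, y). f x y) \<in> borel_measurable (M \<Otimes>\<^sub>M N)"
    and L: "L \<in> M \<rightarrow>\<^sub>M subprob_algebra N"
  shows "(\<lambda>x. \<integral>y. f x y \<partial>L x) \<in> borel_measurable M"
proof -
  have "(\<lambda>x. \<integral>z. z \<partial>distr (L x) borel (f x)) \<in> borel_measurable M"
    by (rule measurable_compose[OF measurable_distr2[OF f L] integral_measurable_subprob_algebra]) simp
  also have "?this \<longleftrightarrow> ?thesis"
  proof (rule measurable_cong)
    fix x assume x: "x \<in> space M"
    have "f x \<in> borel_measurable N"
      using measurable_compose[OF measurable_Pair1'[OF x] f] by simp
    then have "f x \<in> borel_measurable (L x)"
      by (simp cong: measurable_cong_sets add: subprob_measurableD(2)[OF L x])
    then show "(\<integral>z. z \<partial>distr (L x) borel (f x)) = (\<integral>y. f x y \<partial>L x)"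
      by (simp add: integral_distr)
  qed
  finally show ?thesis .
qed

lemma measurable_posterior_mean:
  fixes f :: "'p \<Rightarrow> 'e::euclidean_space" and g :: "'d2 \<Rightarrow> 'e"
  assumes post[measurable]: "post \<in> N1 \<rightarrow>\<^sub>M subprob_algebra prior"
    and [measurable]: "f \<in> borel_measurable prior" "g \<in> borel_measurable N2"
    and \<Delta>: "\<And>\<psi> d2. \<psi> \<in> space prior \<Longrightarrow> d2 \<in> space N2 \<Longrightarrow> \<Delta> \<psi> d2 = g d2 \<bullet> f \<psi>"
  shows "(\<lambda>(d1, d2). posterior_mean post \<Delta> d1 d2) \<in> borel_measurable (N1 \<Otimes>\<^sub>M N2)"
proof -
  have "(\<lambda>z. \<integral>\<psi>. g (snd z) \<bullet> f \<psi> \<partial>post (fst z)) \<in> borel_measurable (N1 \<Otimes>\<^sub>M N2)"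
    \<comment> \<open>The kernel is indexed by the pair \<open>z\<close> of both splits, although
      its measure depends on the first split only.\<close>
    by (rule measurable_integral_kernel[where N = prior]) measurable
  also have "?this \<longleftrightarrow> ?thesis"
  proof (rule measurable_cong)
    fix z assume "z \<in> space (N1 \<Otimes>\<^sub>M N2)"
    then have z: "fst z \<in> space N1" "snd z \<in> space N2"
      by (auto simp: space_pair_measure)
    \<comment> \<open>The bilinear form of \<open>\<Delta>\<close> is assumed on
      \<open>space prior\<close> only, so the posterior must live on that space for the integrands
      to agree.\<close>
    have "space (post (fst z)) = space prior"
      using post z(1) by (rule subprob_measurableD)
    then show "(\<integral>\<psi>. g (snd z) \<bullet> f \<psi> \<partial>post (fst z)) = (case z of (d1, d2) \<Rightarrow> posterior_mean post \<Delta> d1 d2)"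
      using z \<Delta> by (auto simp: posterior_mean_def case_prod_beta' intro!: Bochner_Integration.integral_cong)
  qed
  finally show ?thesis .
qed

theorem mainTheorem3:
  fixes M :: "'w measure"
    and N1 :: "'d1 measure" and D1 :: "'w \<Rightarrow> 'd1"
    and N2 :: "'d2 measure" and D2 :: "'w \<Rightarrow> 'd2"
    and P1 :: "'d1 measure" and P2 :: "'d2 measure"
    and prior :: "'p measure" and lik :: "'p \<Rightarrow> 'd1 measure" and post :: "'d1 \<Rightarrow> 'p measure"
    and \<Delta> :: "'p \<Rightarrow> 'd2 \<Rightarrow> real"
    and f :: "'p \<Rightarrow> 'e::euclidean_space" and g :: "'d2 \<Rightarrow> 'e"
  assumes "prob_space M"
    and indep: "indep_rvs M N1 D1 N2 D2"
    and P1: "P1 = distr M N1 D1"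
    and P2: "P2 = distr M N2 D2"
    and post: "is_posterior N1 prior lik post"
    and f: "f \<in> borel_measurable prior"
    and g: "g \<in> borel_measurable N2"
    and \<Delta>: "\<And>\<psi> d2. \<psi> \<in> space prior \<Longrightarrow> d2 \<in> space N2 \<Longrightarrow> \<Delta> \<psi> d2 = g d2 \<bullet> f \<psi>"
    and post_exists:
      "AE d2 in P2. AE d1 in P1. integrable (post d1) (\<lambda>\<psi>. \<Delta> \<psi> d2)"
    and lhs_var_exists:
      "AE d2 in P2. finite_variance P1 (\<lambda>d1. posterior_mean post \<Delta> d1 d2)"
    and lhs_exists:
      "integrable P2 (\<lambda>d2. prob_space.variance P1 (\<lambda>d1. posterior_mean post \<Delta> d1 d2))"
    and rhs_mean_exists:
      "AE d1 in P1. integrable P2 (\<lambda>d2. posterior_mean post \<Delta> d1 d2)"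
    and rhs_exists:
      "finite_variance P1 (\<lambda>d1. prob_space.expectation P2 (\<lambda>d2. posterior_mean post \<Delta> d1 d2))"
  shows
    "prob_space.expectation P2
       (\<lambda>d2. prob_space.variance P1 (\<lambda>d1. posterior_mean post \<Delta> d1 d2))
     \<ge> prob_space.variance P1
       (\<lambda>d1. prob_space.expectation P2 (\<lambda>d2. posterior_mean post \<Delta> d1 d2))"
proof -
  have D: "D1 \<in> M \<rightarrow>\<^sub>M N1" "D2 \<in> M \<rightarrow>\<^sub>M N2"
    using indep by (auto simp: indep_rvs_def)
  interpret M: prob_space M by fact
  interpret P1: prob_space P1 unfolding P1 using D(1) by (rule M.prob_space_distr)
  interpret P2: prob_space P2 unfolding P2 using D(2) by (rule M.prob_space_distr)
  \<comment> \<open>Both sides are iterated integrals against \<open>P1\<close> and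
    \<open>P2\<close>, so Fubini is used on their product, which by independence is the joint law of
    the two splits.\<close>
  interpret pair_prob_space P1 P2 ..
  have "post \<in> N1 \<rightarrow>\<^sub>M subprob_algebra prior"
    using post by (auto simp: is_posterior_def intro: measurable_prob_algebraD)
  from measurable_posterior_mean[OF this f g \<Delta>]
  have "(\<lambda>(d1, d2). posterior_mean post \<Delta> d1 d2) \<in> borel_measurable (N1 \<Otimes>\<^sub>M N2)" .
  also have "borel_measurable (N1 \<Otimes>\<^sub>M N2) = borel_measurable (P1 \<Otimes>\<^sub>M P2)"
    by (intro measurable_cong_sets sets_pair_measure_cong) (simp_all add: P1 P2)
  finally show ?thesis
    using lhs_var_exists lhs_exists rhs_mean_exists
    by (rule variance_expectation_le_expectation_variance)
qed

end
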